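(* Let $0<k<m$ be integers, let $K$ be a simplex of diameter $h_K>0$ belonging to a regular mesh $\mathcal T_h$ of $\Omega$, and let $u\in H^{m+1}(\Omega)$ be the solution of the variational problem $a(u,v)=l(v)$ for all $v\in V$. For $i\in\{k,m\}$ let $X_K^{(i)}(h_K)=\|u-\Pi_K^{(i)}u\|_{1,K}$ be the local interpolation errors, treated as random variables, and assume that $X_K^{(k)}(h_K)$ and $X_K^{(m)}(h_K)$ are independent and uniformly distributed on $[0,C_k'h_K^k]$ and $[0,C_m'h_K^m]$ respectively. Let $h^*=(C_k'/C_m')^{1/(m-k)}$. Then the probability that "$P_m$ is locally more accurate than $P_k$ on $K$" is $$\mathrm{Prob}\{X_K^{(m)}(h_K)\le X_K^{(k)}(h_K)\}=\begin{cases}1-\dfrac12\left(\dfrac{h_K}{h^*}\right)^{m-k}&\text{if }0<h_K\le h^*,\\[2mm]\dfrac12\left(\dfrac{h^*}{h_K}\right)^{m-k}&\text{if }h_K\ge h^*.\end{cases}$$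
   Context: $\Omega\subset\mathbb R^d$ is a nonempty bounded open set with piecewise $C^1$ boundary; $V$ is a Hilbert Sobolev space on $\Omega$, $a$ is a bilinear, continuous, $V$-elliptic form on $V\times V$, and $l$ is a continuous linear form on $V$. $\Pi_K^{(i)}$ is the local Lagrange interpolation operator of degree $i$ on the simplex $K$ (with values in polynomials of degree at most $i$), and $\|\cdot\|_{1,K}$ is the $H^1(K)$ norm. The constants are $C_i'=\mathscr C_i'\,|u|_{i+1,\Omega}>0$, where $|\cdot|_{i+1,\Omega}$ is the $H^{i+1}(\Omega)$ semi-norm and $\mathscr C_i'>0$ is a constant, independent of $K$ and $h_K$, such that $\|u-\Pi_K^{(i)}u\|_{1,K}\le \mathscr C_i'\,h_K^i\,|u|_{i+1,\Omega}$. "$P_m$ is locally more accurate than $P_k$ on $K$" means $\|u-\Pi_K^{(m)}u\|_{1,K}\le\|u-\Pi_K^{(k)}u\|_{1,K}$. *)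

theory Defs
  imports "HOL-Probability.Probability"
begin

section \<open>Bounded domains with piecewise C1 boundary\<close>

text \<open>A C1 patch of codimension 1: the image of a flat closed \<open>(d-1)\<close>-simplex under a C1
  diffeomorphism of an open neighbourhood of it in the ambient space.\<close>

definition C1_patch :: "(real^'d) set \<Rightarrow> bool" where
  "C1_patch S \<longleftrightarrow> (\<exists>T U (\<phi> :: real^'d \<Rightarrow> real^'d) (\<phi>' :: real^'d \<Rightarrow> (real^'d) \<Rightarrow>\<^sub>L (real^'d)).
     (int CARD('d) - 1) simplex T \<and> T \<subseteq> U \<and> open U \<and> inj_on \<phi> U \<and>
     (\<forall>x\<in>U. (\<phi> has_derivative blinfun_apply (\<phi>' x)) (at x) \<and> bij (blinfun_apply (\<phi>' x))) \<and>
     continuous_on U \<phi>' \<and> S = \<phi> ` T)"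

definition piecewise_C1_boundary :: "(real^'d) set \<Rightarrow> bool" where
  "piecewise_C1_boundary \<Omega> \<longleftrightarrow>
     (\<exists>\<P>. finite \<P> \<and> (\<forall>S\<in>\<P>. C1_patch S) \<and> frontier \<Omega> = \<Union>\<P>)"


section \<open>Sobolev spaces \<open>H\<^sup>n\<close>\<close>

text \<open>Multi-indices are functions \<open>\<alpha> :: 'd \<Rightarrow> nat\<close> on the finite set of coordinates, of length
  \<open>sum \<alpha> UNIV\<close>.\<close>

definition partial_deriv :: "'d \<Rightarrow> (real^'d \<Rightarrow> real) \<Rightarrow> real^'d \<Rightarrow> real" where
  "partial_deriv i f x = frechet_derivative f (at x) (axis i 1)"

definition iter_partial :: "'d list \<Rightarrow> (real^'d \<Rightarrow> real) \<Rightarrow> real^'d \<Rightarrow> real" where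
  "iter_partial js f = foldr partial_deriv js f"

text \<open>The order of differentiation is picked arbitrarily; this operator is only applied to smooth
  functions, for which it is irrelevant.\<close>

definition multi_deriv :: "('d \<Rightarrow> nat) \<Rightarrow> (real^'d \<Rightarrow> real) \<Rightarrow> real^'d \<Rightarrow> real" where
  "multi_deriv \<alpha> f = iter_partial (SOME js. \<forall>i. count_list js i = \<alpha> i) f"

definition smooth :: "(real^'d \<Rightarrow> real) \<Rightarrow> bool" where
  "smooth f \<longleftrightarrow> (\<forall>js x. iter_partial js f differentiable (at x))"

definition test_functions :: "(real^'d) set \<Rightarrow> (real^'d \<Rightarrow> real) set" where
  "test_functions \<Omega> =
     {\<phi>. smooth \<phi> \<and> compact (closure {x. \<phi> x \<noteq> 0}) \<and> closure {x. \<phi> x \<noteq> 0} \<subseteq> \<Omega>}"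

text \<open>Elements of \<open>L\<^sup>2\<close> and of the Sobolev spaces are represented by functions rather than by
  classes modulo equality almost everywhere; values outside \<open>\<Omega>\<close> play no role.\<close>

definition L2 :: "(real^'d) set \<Rightarrow> (real^'d \<Rightarrow> real) set" where
  "L2 \<Omega> = {f. f \<in> borel_measurable (lebesgue_on \<Omega>) \<and> integrable (lebesgue_on \<Omega>) (\<lambda>x. (f x)\<^sup>2)}"

definition has_weak_deriv ::
    "(real^'d) set \<Rightarrow> ('d \<Rightarrow> nat) \<Rightarrow> (real^'d \<Rightarrow> real) \<Rightarrow> (real^'d \<Rightarrow> real) \<Rightarrow> bool" where
  "has_weak_deriv \<Omega> \<alpha> u v \<longleftrightarrow>
     (\<forall>\<phi>\<in>test_functions \<Omega>.
        integral\<^sup>L (lebesgue_on \<Omega>) (\<lambda>x. u x * multi_deriv \<alpha> \<phi> x)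
          = (-1) ^ (sum \<alpha> UNIV) * integral\<^sup>L (lebesgue_on \<Omega>) (\<lambda>x. v x * \<phi> x))"

definition sobolev :: "nat \<Rightarrow> (real^'d) set \<Rightarrow> (real^'d \<Rightarrow> real) set" where
  "sobolev n \<Omega> = {u \<in> L2 \<Omega>. \<forall>\<alpha>. sum \<alpha> UNIV \<le> n \<longrightarrow> (\<exists>v\<in>L2 \<Omega>. has_weak_deriv \<Omega> \<alpha> u v)}"

text \<open>Well defined up to a null set of \<open>\<Omega>\<close> whenever it exists.\<close>

definition weak_deriv ::
    "(real^'d) set \<Rightarrow> ('d \<Rightarrow> nat) \<Rightarrow> (real^'d \<Rightarrow> real) \<Rightarrow> real^'d \<Rightarrow> real" where
  "weak_deriv \<Omega> \<alpha> u = (SOME v. v \<in> L2 \<Omega> \<and> has_weak_deriv \<Omega> \<alpha> u v)"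

definition sobolev_seminorm :: "nat \<Rightarrow> (real^'d) set \<Rightarrow> (real^'d \<Rightarrow> real) \<Rightarrow> real" where
  "sobolev_seminorm n \<Omega> u =
     sqrt (\<Sum>\<alpha> | sum \<alpha> UNIV = n. integral\<^sup>L (lebesgue_on \<Omega>) (\<lambda>x. (weak_deriv \<Omega> \<alpha> u x)\<^sup>2))"

definition sobolev_norm :: "nat \<Rightarrow> (real^'d) set \<Rightarrow> (real^'d \<Rightarrow> real) \<Rightarrow> real" where
  "sobolev_norm n \<Omega> u =
     sqrt (\<Sum>\<alpha> | sum \<alpha> UNIV \<le> n. integral\<^sup>L (lebesgue_on \<Omega>) (\<lambda>x. (weak_deriv \<Omega> \<alpha> u x)\<^sup>2))"


section \<open>The variational problem\<close>

text \<open>A linear subspace of \<open>H\<^sup>r(\<Omega>)\<close> that is complete for the \<open>H\<^sup>r\<close> norm. This covers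
  \<open>H\<^sup>r(\<Omega>)\<close> itself and its closed subspaces given by homogeneous boundary conditions.\<close>

definition hilbert_sobolev_space :: "nat \<Rightarrow> (real^'d) set \<Rightarrow> (real^'d \<Rightarrow> real) set \<Rightarrow> bool" where
  "hilbert_sobolev_space r \<Omega> V \<longleftrightarrow>
     V \<subseteq> sobolev r \<Omega> \<and> (\<lambda>x. 0) \<in> V \<and>
     (\<forall>v\<in>V. \<forall>w\<in>V. (\<lambda>x. v x + w x) \<in> V) \<and>
     (\<forall>c. \<forall>v\<in>V. (\<lambda>x. c * v x) \<in> V) \<and>
     (\<forall>f :: nat \<Rightarrow> real^'d \<Rightarrow> real.
        (\<forall>n. f n \<in> V) \<and>
        (\<forall>e>0. \<exists>N. \<forall>p\<ge>N. \<forall>q\<ge>N. sobolev_norm r \<Omega> (\<lambda>x. f p x - f q x) < e) \<longrightarrow>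
        (\<exists>g\<in>V. (\<lambda>n. sobolev_norm r \<Omega> (\<lambda>x. f n x - g x)) \<longlonglongrightarrow> 0))"

definition linear_form_on :: "(real^'d \<Rightarrow> real) set \<Rightarrow> ((real^'d \<Rightarrow> real) \<Rightarrow> real) \<Rightarrow> bool" where
  "linear_form_on V l \<longleftrightarrow>
     (\<forall>v\<in>V. \<forall>w\<in>V. l (\<lambda>x. v x + w x) = l v + l w) \<and>
     (\<forall>c. \<forall>v\<in>V. l (\<lambda>x. c * v x) = c * l v)"

definition continuous_linear_form ::
    "nat \<Rightarrow> (real^'d) set \<Rightarrow> (real^'d \<Rightarrow> real) set \<Rightarrow> ((real^'d \<Rightarrow> real) \<Rightarrow> real) \<Rightarrow> bool" where
  "continuous_linear_form r \<Omega> V l \<longleftrightarrow>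
     linear_form_on V l \<and> (\<exists>C. \<forall>v\<in>V. \<bar>l v\<bar> \<le> C * sobolev_norm r \<Omega> v)"

definition continuous_bilinear_form ::
    "nat \<Rightarrow> (real^'d) set \<Rightarrow> (real^'d \<Rightarrow> real) set
       \<Rightarrow> ((real^'d \<Rightarrow> real) \<Rightarrow> (real^'d \<Rightarrow> real) \<Rightarrow> real) \<Rightarrow> bool" where
  "continuous_bilinear_form r \<Omega> V a \<longleftrightarrow>
     (\<forall>v\<in>V. linear_form_on V (\<lambda>w. a v w)) \<and> (\<forall>w\<in>V. linear_form_on V (\<lambda>v. a v w)) \<and>
     (\<exists>C. \<forall>v\<in>V. \<forall>w\<in>V. \<bar>a v w\<bar> \<le> C * sobolev_norm r \<Omega> v * sobolev_norm r \<Omega> w)"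

definition elliptic_form ::
    "nat \<Rightarrow> (real^'d) set \<Rightarrow> (real^'d \<Rightarrow> real) set
       \<Rightarrow> ((real^'d \<Rightarrow> real) \<Rightarrow> (real^'d \<Rightarrow> real) \<Rightarrow> real) \<Rightarrow> bool" where
  "elliptic_form r \<Omega> V a \<longleftrightarrow> (\<exists>c>0. \<forall>v\<in>V. a v v \<ge> c * (sobolev_norm r \<Omega> v)\<^sup>2)"

definition variational_solution ::
    "(real^'d \<Rightarrow> real) set \<Rightarrow> ((real^'d \<Rightarrow> real) \<Rightarrow> (real^'d \<Rightarrow> real) \<Rightarrow> real)
       \<Rightarrow> ((real^'d \<Rightarrow> real) \<Rightarrow> real) \<Rightarrow> (real^'d \<Rightarrow> real) \<Rightarrow> bool" where
  "variational_solution V a l u \<longleftrightarrow> u \<in> V \<and> (\<forall>v\<in>V. a u v = l v)"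


section \<open>Regular meshes\<close>

text \<open>A conforming covering by nondegenerate closed simplices. The condition on the interiors is
  automatic when \<open>\<Omega>\<close> is the interior of its closure; for slit domains it prevents a slit from
  crossing an element.\<close>

definition simplicial_mesh :: "(real^'d) set \<Rightarrow> (real^'d) set set \<Rightarrow> bool" where
  "simplicial_mesh \<Omega> \<T> \<longleftrightarrow>
     triangulation \<T> \<and> (\<forall>K\<in>\<T>. (int CARD('d)) simplex K \<and> interior K \<subseteq> \<Omega>) \<and>
     \<Union>\<T> = closure \<Omega>"

text \<open>The diameter of the largest ball contained in \<open>K\<close>.\<close>

definition inball_diameter :: "(real^'d) set \<Rightarrow> real" where
  "inball_diameter K = Sup {2 * r | r x. 0 \<le> r \<and> cball x r \<subseteq> K}"

text \<open>Regularity in the sense of Ciarlet is a property of the family of meshes \<open>\<T> h\<close>, indexed by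
  their mesh size \<open>h\<close>: the aspect ratios are bounded uniformly and \<open>h\<close> tends to 0. For a single
  mesh it would be void.\<close>

definition regular_mesh_family ::
    "(real^'d) set \<Rightarrow> real set \<Rightarrow> (real \<Rightarrow> (real^'d) set set) \<Rightarrow> bool" where
  "regular_mesh_family \<Omega> H \<T> \<longleftrightarrow>
     H \<subseteq> {0<..} \<and> 0 islimpt H \<and>
     (\<forall>h\<in>H. simplicial_mesh \<Omega> (\<T> h) \<and> h = Max (diameter ` \<T> h)) \<and>
     (\<exists>\<sigma>>0. \<forall>h\<in>H. \<forall>K\<in>\<T> h. diameter K \<le> \<sigma> * inball_diameter K)"


section \<open>Local Lagrange interpolation\<close>

definition polys_upto :: "nat \<Rightarrow> (real^'d \<Rightarrow> real) set" where
  "polys_upto i =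
     {p. \<exists>c :: ('d \<Rightarrow> nat) \<Rightarrow> real. p = (\<lambda>x. \<Sum>\<alpha> | sum \<alpha> UNIV \<le> i. c \<alpha> * (\<Prod>j\<in>UNIV. (x $ j) ^ \<alpha> j))}"

text \<open>The principal lattice: the points of \<open>K\<close> whose barycentric coordinates are multiples
  of \<open>1/i\<close>.\<close>

definition lagrange_nodes :: "nat \<Rightarrow> (real^'d) set \<Rightarrow> (real^'d) set" where
  "lagrange_nodes i K =
     (let S = {x. x extreme_point_of K} in
      {(\<Sum>v\<in>S. (real (\<beta> v) / real i) *\<^sub>R v) | \<beta> :: real^'d \<Rightarrow> nat. sum \<beta> S = i})"

text \<open>Point values of a Sobolev function are those of its continuous representative on \<open>K\<close>, which
  is unique if it exists because \<open>K\<close> is the closure of its interior.\<close>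

definition continuous_rep :: "(real^'d) set \<Rightarrow> (real^'d \<Rightarrow> real) \<Rightarrow> real^'d \<Rightarrow> real" where
  "continuous_rep K u = (SOME g. continuous_on K g \<and> (AE x in lebesgue_on K. g x = u x))"

definition lagrange_interp :: "nat \<Rightarrow> (real^'d) set \<Rightarrow> (real^'d \<Rightarrow> real) \<Rightarrow> real^'d \<Rightarrow> real" where
  "lagrange_interp i K u =
     (THE p. p \<in> polys_upto i \<and> (\<forall>x\<in>lagrange_nodes i K. p x = continuous_rep K u x))"

definition local_error :: "nat \<Rightarrow> (real^'d) set \<Rightarrow> (real^'d \<Rightarrow> real) \<Rightarrow> real" where
  "local_error i K u = sobolev_norm 1 (interior K) (\<lambda>x. u x - lagrange_interp i K u x)"

text \<open>For given \<open>u\<close> and \<open>K\<close> the local errors are real numbers. Treating them as random variables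
  \<open>X i\<close> means that these numbers are the values of the \<open>X i\<close> at one common outcome. They cannot
  simply be equated with \<open>X i\<close> at every outcome: a single number is not uniformly distributed.\<close>

definition random_local_errors ::
    "'w measure \<Rightarrow> nat set \<Rightarrow> (nat \<Rightarrow> 'w \<Rightarrow> real) \<Rightarrow> (real^'d) set \<Rightarrow> (real^'d \<Rightarrow> real) \<Rightarrow> bool" where
  "random_local_errors M I X K u \<longleftrightarrow>
     (\<forall>i\<in>I. X i \<in> borel_measurable M) \<and>
     (\<exists>\<omega>\<in>space M. \<forall>i\<in>I. X i \<omega> = local_error i K u)"

end

theory Submission
  imports Defs
begin

text \<open>Condition on one of the two errors. If \<open>X\<close> and \<open>Y\<close> are independent and uniform on \<open>[0, A]\<close>
  and \<open>[0, B]\<close> with \<open>A \<le> B\<close>, then the distribution function of \<open>Y\<close> is \<open>x / B\<close> on the whole range of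
  \<open>X\<close>, so \<open>P(Y \<le> X) = E[X] / B = A / (2 B)\<close>. When \<open>A \<ge> B\<close> the roles are exchanged, and ties are
  negligible. Finally \<open>B / A = (h\<^sub>K / h\<^sup>*)\<^sup>m\<^sup>-\<^sup>k\<close>.\<close>

text \<open>Independence makes the joint law the product of the two marginal laws, so Tonelli
  integrates the measures of the sections. Both marginals are then pulled back to \<open>M\<close>:
  \<open>X \<omega>\<close> is frozen while \<open>Y\<close> is sampled at a separate outcome
  \<open>\<omega>'\<close>. This is the form in which conditioning on \<open>X\<close> is used
  below.\<close>

lemma (in prob_space) indep_var_emeasure_section:
  assumes ind: "indep_var S X T Y" and P: "Measurable.pred (S \<Otimes>\<^sub>M T) (\<lambda>z. P (fst z) (snd z))"
  shows "emeasure M {\<omega>\<in>space M. P (X \<omega>) (Y \<omega>)}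
       = (\<integral>\<^sup>+\<omega>. emeasure M {\<omega>'\<in>space M. P (X \<omega>) (Y \<omega>')} \<partial>M)"
proof -
  have X[measurable]: "X \<in> measurable M S" and Y[measurable]: "Y \<in> measurable M T"
    and eq: "distr M S X \<Otimes>\<^sub>M distr M T Y = distr M (S \<Otimes>\<^sub>M T) (\<lambda>x. (X x, Y x))"
    using ind by (auto simp: indep_var_distribution_eq)
  interpret Y: prob_space "distr M T Y" by (rule prob_space_distr) fact
  define Z where "Z = {z \<in> space (S \<Otimes>\<^sub>M T). P (fst z) (snd z)}"
  have Z[measurable]: "Z \<in> sets (S \<Otimes>\<^sub>M T)" using P unfolding Z_def by measurable
  \<comment> \<open>The section of \<open>Z\<close> over the value \<open>X \<omega>\<close>,
    measured by the law of \<open>Y\<close>, is the inner event of the claim.\<close>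
  have sec: "emeasure (distr M T Y) (Pair (X \<omega>) -` Z) = emeasure M {\<omega>'\<in>space M. P (X \<omega>) (Y \<omega>')}"
    if "\<omega> \<in> space M" for \<omega>
    using sets_Pair1[OF Z, of "X \<omega>"] measurable_space[OF X that] measurable_space[OF Y]
    by (subst emeasure_distr)
       (auto simp: Z_def space_pair_measure intro!: arg_cong[where f = "emeasure M"])
  have "emeasure M {\<omega>\<in>space M. P (X \<omega>) (Y \<omega>)} = emeasure (distr M (S \<Otimes>\<^sub>M T) (\<lambda>x. (X x, Y x))) Z"
    using measurable_space[OF X] measurable_space[OF Y]
    by (subst emeasure_distr[OF _ Z])
       (auto simp: Z_def space_pair_measure intro!: arg_cong[where f = "emeasure M"])
  also have "\<dots> = (\<integral>\<^sup>+x. emeasure (distr M T Y) (Pair x -` Z) \<partial>distr M S X)"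
    unfolding eq[symmetric] by (rule Y.emeasure_pair_measure_alt) simp
  also have "\<dots> = (\<integral>\<^sup>+\<omega>. emeasure (distr M T Y) (Pair (X \<omega>) -` Z) \<partial>M)"
    by (subst nn_integral_distr) (auto intro!: Y.measurable_emeasure_Pair)
  also have "\<dots> = (\<integral>\<^sup>+\<omega>. emeasure M {\<omega>'\<in>space M. P (X \<omega>) (Y \<omega>')} \<partial>M)"
    by (rule nn_integral_cong) (rule sec)
  finally show ?thesis .
qed

lemma (in prob_space) indep_set_sym:
  assumes "indep_set A B"
  shows "indep_set B A"
proof -
  have *: "A \<subseteq> events" "B \<subseteq> events" "\<And>a b. a \<in> A \<Longrightarrow> b \<in> B \<Longrightarrow> prob (a \<inter> b) = prob a * prob b"
    using assms by (auto simp: indep_sets2_eq)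
  have "prob (b \<inter> a) = prob b * prob a" if "b \<in> B" "a \<in> A" for a b
    using *(3)[OF that(2,1)] by (simp add: Int_commute[of b] mult.commute[of "prob b"])
  with * show ?thesis by (auto simp: indep_sets2_eq)
qed

text \<open>Serves the exchange of roles when the conditioning variable is the one with the longer
  range.\<close>

lemma (in prob_space) indep_var_sym:
  assumes "indep_var S X T Y"
  shows "indep_var T Y S X"
  using assms unfolding indep_var_eq by (blast intro: indep_set_sym)

text \<open>The density vanishes off the interval. Being uniform constrains only the law, so values
  outside can be excluded only up to a null set.\<close>

lemma (in prob_space) uniform_distributed_AE:
  fixes a b :: real
  assumes D: "distributed M lborel X (\<lambda>x. indicator {a..b} x / measure lborel {a..b})"
  shows "AE \<omega> in M. X \<omega> \<in> {a..b}"
proof -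
  have "AE x in distr M lborel X. x \<in> {a..b}"
    unfolding distributed_distr_eq_density[OF D]
    using distributed_borel_measurable[OF D]
    by (subst AE_density) (auto simp: indicator_def)
  then show ?thesis
    using distributed_measurable[OF D] by (subst (asm) AE_distr_iff) auto
qed

text \<open>A law with a Lebesgue density has no atoms, since singletons are Lebesgue null.\<close>

lemma (in prob_space) prob_distributed_lborel_eq_0:
  assumes D: "distributed M lborel X f"
  shows "emeasure M {\<omega>\<in>space M. X \<omega> = c} = 0"
proof -
  have "AE x in distr M lborel X. x \<noteq> c"
    unfolding distributed_distr_eq_density[OF D]
    using distributed_borel_measurable[OF D] AE_lborel_singleton[of c]
    by (subst AE_density) auto
  then have "AE \<omega> in M. X \<omega> \<noteq> c"
    using distributed_measurable[OF D] by (subst (asm) AE_distr_iff) auto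
  then show ?thesis
    using distributed_measurable[OF D] by (subst (asm) AE_iff_measurable[OF _ refl]) auto
qed

lemma (in prob_space) prob_indep_uniform_le:
  fixes A B :: real
  assumes ind: "indep_var borel X borel Y"
    and X: "distributed M lborel X (\<lambda>x. indicator {0..A} x / measure lborel {0..A})"
    and Y: "distributed M lborel Y (\<lambda>x. indicator {0..B} x / measure lborel {0..B})"
    and AB: "A \<le> B"
  shows "prob {\<omega>\<in>space M. Y \<omega> \<le> X \<omega>} = A / (2 * B)"
proof -
  \<comment> \<open>A uniform law forces a nondegenerate interval: otherwise the density would be
    zero almost everywhere and could not have total mass 1.\<close>
  have pos: "0 < A" "0 < B"
    using uniform_distributed_bounds[OF X] uniform_distributed_bounds[OF Y] .
  have [measurable]: "X \<in> borel_measurable M"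
    using distributed_measurable[OF X] by simp
  have range: "AE \<omega> in M. X \<omega> \<in> {0..A}" by (rule uniform_distributed_AE[OF X])
  have int: "integrable M (\<lambda>\<omega>. X \<omega> / B)"
  proof (rule integrable_const_bound)
    show "AE \<omega> in M. norm (X \<omega> / B) \<le> A / B"
      using range by eventually_elim (use pos in \<open>simp add: divide_right_mono\<close>)
  qed measurable
  have "emeasure M {\<omega>\<in>space M. Y \<omega> \<le> X \<omega>}
      = (\<integral>\<^sup>+\<omega>. emeasure M {\<omega>'\<in>space M. Y \<omega>' \<le> X \<omega>} \<partial>M)"
    by (rule indep_var_emeasure_section[OF ind, of "\<lambda>x y. y \<le> x"]) measurable
  also have "\<dots> = (\<integral>\<^sup>+\<omega>. ennreal (X \<omega> / B) \<partial>M)"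
  proof (rule nn_integral_cong_AE)
    \<comment> \<open>Here \<open>A \<le> B\<close> enters: almost surely \<open>X \<omega>\<close>
      lies in \<open>{0..A}\<close>, hence in \<open>{0..B}\<close>, where the distribution function
      of \<open>Y\<close> is linear with slope \<open>1 / B\<close>.\<close>
    show "AE \<omega> in M. emeasure M {\<omega>'\<in>space M. Y \<omega>' \<le> X \<omega>} = ennreal (X \<omega> / B)"
      using range
      by eventually_elim (use AB in \<open>simp add: emeasure_eq_measure uniform_distributed_measure[OF Y]\<close>)
  qed
  also have "\<dots> = ennreal (expectation (\<lambda>\<omega>. X \<omega> / B))"
  proof (rule nn_integral_eq_integral[OF int])
    show "AE \<omega> in M. 0 \<le> X \<omega> / B"
      using range by eventually_elim (use pos in simp)
  qed
  \<comment> \<open>The mean of \<open>X\<close> is the midpoint \<open>A / 2\<close>.\<close>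
  also have "expectation (\<lambda>\<omega>. X \<omega> / B) = A / (2 * B)"
    using uniform_distributed_expectation[OF X] pos by (simp add: field_simps)
  finally show ?thesis
    using pos by (simp add: emeasure_eq_measure)
qed

text \<open>Once \<open>X\<close> is frozen, a tie asks \<open>Y\<close> to hit one prescribed
  point, which has probability 0; integrating over \<open>X\<close> keeps it 0.\<close>

lemma (in prob_space) prob_indep_distributed_eq_0:
  fixes X Y :: "'a \<Rightarrow> real"
  assumes ind: "indep_var borel X borel Y" and Y: "distributed M lborel Y f"
  shows "prob {\<omega>\<in>space M. X \<omega> = Y \<omega>} = 0"
proof -
  have "emeasure M {\<omega>\<in>space M. X \<omega> = Y \<omega>}
      = (\<integral>\<^sup>+\<omega>. emeasure M {\<omega>'\<in>space M. X \<omega> = Y \<omega>'} \<partial>M)"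
    by (rule indep_var_emeasure_section[OF ind]) measurable
  also have "\<dots> = 0"
    by (simp add: prob_distributed_lborel_eq_0[OF Y] eq_commute[of "X _"])
  finally show ?thesis by (simp add: measure_def)
qed

lemma (in prob_space) prob_indep_uniform_ge:
  fixes A B :: real
  assumes ind: "indep_var borel X borel Y"
    and X: "distributed M lborel X (\<lambda>x. indicator {0..A} x / measure lborel {0..A})"
    and Y: "distributed M lborel Y (\<lambda>x. indicator {0..B} x / measure lborel {0..B})"
    and BA: "B \<le> A"
  shows "prob {\<omega>\<in>space M. Y \<omega> \<le> X \<omega>} = 1 - B / (2 * A)"
proof -
  have [measurable]: "X \<in> borel_measurable M" "Y \<in> borel_measurable M"
    using distributed_measurable[OF X] distributed_measurable[OF Y] by simp_all
  \<comment> \<open>Inclusion-exclusion: the two events cover the space and overlap only in ties, so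
    their probabilities add up to 1. The second one is \<open>B / (2 * A)\<close> by the previous
    case with \<open>X\<close> and \<open>Y\<close> exchanged.\<close>
  have "prob ({\<omega>\<in>space M. Y \<omega> \<le> X \<omega>} \<union> {\<omega>\<in>space M. X \<omega> \<le> Y \<omega>})
      = prob {\<omega>\<in>space M. Y \<omega> \<le> X \<omega>} + prob {\<omega>\<in>space M. X \<omega> \<le> Y \<omega>}
        - prob ({\<omega>\<in>space M. Y \<omega> \<le> X \<omega>} \<inter> {\<omega>\<in>space M. X \<omega> \<le> Y \<omega>})"
    by (rule measure_Un3) (auto simp: fmeasurable_eq_sets)
  moreover have "{\<omega>\<in>space M. Y \<omega> \<le> X \<omega>} \<union> {\<omega>\<in>space M. X \<omega> \<le> Y \<omega>} = space M"
    by auto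
  moreover have "{\<omega>\<in>space M. Y \<omega> \<le> X \<omega>} \<inter> {\<omega>\<in>space M. X \<omega> \<le> Y \<omega>} = {\<omega>\<in>space M. X \<omega> = Y \<omega>}"
    by auto
  ultimately show ?thesis
    using prob_indep_uniform_le[OF indep_var_sym[OF ind] Y X BA]
      prob_indep_distributed_eq_0[OF ind Y] by (simp add: prob_space)
qed

theorem corollary4p2:
  fixes \<Omega> :: "(real^'d) set"
    and V :: "(real^'d \<Rightarrow> real) set"
    and a :: "(real^'d \<Rightarrow> real) \<Rightarrow> (real^'d \<Rightarrow> real) \<Rightarrow> real"
    and l :: "(real^'d \<Rightarrow> real) \<Rightarrow> real"
    and u :: "real^'d \<Rightarrow> real"
    and H :: "real set" and \<T> :: "real \<Rightarrow> (real^'d) set set"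
    and K :: "(real^'d) set"
    and k m r :: nat
    and h h\<^sub>K hstar :: real
    and \<C> C :: "nat \<Rightarrow> real"
    and M :: "'w measure" and X :: "nat \<Rightarrow> 'w \<Rightarrow> real"
  assumes "0 < k" and "k < m"
    and "open \<Omega>" and "bounded \<Omega>" and "\<Omega> \<noteq> {}" and "piecewise_C1_boundary \<Omega>"
    and "hilbert_sobolev_space r \<Omega> V"
    and "continuous_bilinear_form r \<Omega> V a" and "elliptic_form r \<Omega> V a"
    and "continuous_linear_form r \<Omega> V l"
    and "u \<in> sobolev (m + 1) \<Omega>" and "variational_solution V a l u"
    and "regular_mesh_family \<Omega> H \<T>" and "h \<in> H" and "K \<in> \<T> h"
    and "h\<^sub>K = diameter K" and "h\<^sub>K > 0"
    and "\<And>i. i \<in> {k, m} \<Longrightarrow> \<C> i > 0"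
    and "\<And>i h' K'. \<lbrakk>i \<in> {k, m}; h' \<in> H; K' \<in> \<T> h'\<rbrakk> \<Longrightarrow>
           local_error i K' u \<le> \<C> i * diameter K' ^ i * sobolev_seminorm (i + 1) \<Omega> u"
    and "\<And>i. i \<in> {k, m} \<Longrightarrow> C i = \<C> i * sobolev_seminorm (i + 1) \<Omega> u"
    and "\<And>i. i \<in> {k, m} \<Longrightarrow> C i > 0"
    and "prob_space M"
    and "random_local_errors M {k, m} X K u"
    and "prob_space.indep_var M borel (X k) borel (X m)"
    and "\<And>i. i \<in> {k, m} \<Longrightarrow>
           distributed M lborel (X i)
             (\<lambda>x. indicator {0..C i * h\<^sub>K ^ i} x / measure lborel {0..C i * h\<^sub>K ^ i})"
    and "hstar = (C k / C m) powr (1 / real (m - k))"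
  shows "(0 < h\<^sub>K \<and> h\<^sub>K \<le> hstar \<longrightarrow>
            measure M {\<omega> \<in> space M. X m \<omega> \<le> X k \<omega>} = 1 - 1/2 * (h\<^sub>K / hstar) ^ (m - k)) \<and>
         (h\<^sub>K \<ge> hstar \<longrightarrow>
            measure M {\<omega> \<in> space M. X m \<omega> \<le> X k \<omega>} = 1/2 * (hstar / h\<^sub>K) ^ (m - k))"
proof -
  interpret prob_space M by fact
  define A B where "A = C k * h\<^sub>K ^ k" and "B = C m * h\<^sub>K ^ m"
  have pos: "C k > 0" "C m > 0" "h\<^sub>K > 0" and n: "0 < m - k" and ABpos: "A > 0" "B > 0"
    using \<open>\<And>i. i \<in> {k, m} \<Longrightarrow> C i > 0\<close>[of k] \<open>\<And>i. i \<in> {k, m} \<Longrightarrow> C i > 0\<close>[of m] \<open>h\<^sub>K > 0\<close> \<open>k < m\<close>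
    by (simp_all add: A_def B_def)
  \<comment> \<open>The real root in \<open>hstar\<close> is undone by the power
    \<open>m - k\<close>, which is positive because \<open>k < m\<close>.\<close>
  have hs: "hstar > 0" and hsp: "hstar ^ (m - k) = C k / C m"
    using pos n unfolding \<open>hstar = _\<close> by (simp_all add: powr_power)
  \<comment> \<open>The probability depends only on the ratio of the two ranges. Cancelling the
    common factor \<open>h\<^sub>K ^ k\<close> leaves
    \<open>C m * h\<^sub>K ^ (m - k) / C k\<close>, so \<open>hstar\<close> is the diameter at which
    both ranges coincide.\<close>
  have BA: "B / A = (h\<^sub>K / hstar) ^ (m - k)"
  proof -
    have "h\<^sub>K ^ m = h\<^sub>K ^ k * h\<^sub>K ^ (m - k)"
      using \<open>k < m\<close> by (simp flip: power_add)
    then show ?thesis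
      using pos by (simp add: A_def B_def power_divide hsp divide_simps)
  qed
  then have AB: "A / B = (hstar / h\<^sub>K) ^ (m - k)"
    by (metis inverse_divide power_inverse)
  note distr = \<open>\<And>i. i \<in> {k, m} \<Longrightarrow> distributed M lborel (X i) _\<close>
  have Dk: "distributed M lborel (X k) (\<lambda>x. indicator {0..A} x / measure lborel {0..A})"
    and Dm: "distributed M lborel (X m) (\<lambda>x. indicator {0..B} x / measure lborel {0..B})"
    unfolding A_def B_def by (rule distr; simp)+
  have ind: "indep_var borel (X k) borel (X m)" by fact
  \<comment> \<open>Comparing \<open>h\<^sub>K\<close> with \<open>hstar\<close> decides which range
    is longer. Both cases include \<open>h\<^sub>K = hstar\<close>, where \<open>A = B\<close> and
    both formulas give 1/2.\<close>
  show ?thesis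
  proof (intro conjI impI)
    assume "0 < h\<^sub>K \<and> h\<^sub>K \<le> hstar"
    then have "B / A \<le> 1"
      unfolding BA using hs by (intro power_le_one) auto
    then have "B \<le> A" using ABpos by (simp add: field_simps)
    from prob_indep_uniform_ge[OF ind Dk Dm this]
    show "prob {\<omega> \<in> space M. X m \<omega> \<le> X k \<omega>} = 1 - 1/2 * (h\<^sub>K / hstar) ^ (m - k)"
      unfolding BA[symmetric] by simp
  next
    assume "hstar \<le> h\<^sub>K"
    then have "A / B \<le> 1"
      unfolding AB using hs pos by (intro power_le_one) auto
    then have "A \<le> B" using ABpos by (simp add: field_simps)
    from prob_indep_uniform_le[OF ind Dk Dm this]
    show "prob {\<omega> \<in> space M. X m \<omega> \<le> X k \<omega>} = 1/2 * (hstar / h\<^sub>K) ^ (m - k)"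
      unfolding AB[symmetric] by simp
  qed
qed

end
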